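(* Consider a run of the stochastic SQP algorithm described in the context, and suppose that the assumption on the event $E_{\tau,\mathrm{zero}}$ (see context) holds. Suppose that $\{\beta_k\}$ is chosen such that, for all $k\in\mathbb{N}$, $$\beta_k\in(0,1]\quad\text{and}\quad \frac{2(1-\eta)\beta_k\xi_k\max\{\tau_k,1\}}{\tau_kL+\Gamma}\in(0,1],$$ and that either (a) $\beta_k=\beta\in(0,1)$ for all $k\in\mathbb{N}$, or (b) $\sum_{k=0}^\infty\beta_k=\infty$, $\sum_{k=0}^\infty\beta_k^2<\infty$, and either $|\{k\in\mathbb{N}:\|u_k\|_2^2<\chi_k\|v_k\|_2^2\}|=\infty$ or $\sum_{k=0}^\infty\beta_k\tau_k=\infty$. Then $\liminf_{k\to\infty}\|J_k^Tc_k\|_2=0$.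
   Context: Problem: minimize $f(x)$ over $x\in\mathbb{R}^n$ subject to $c(x)=0$, where $f(x)=\mathbb{E}[F(x,\iota)]$, $\iota$ is a random variable, $c:\mathbb{R}^n\to\mathbb{R}^m$ with $m\le n$, and $J(x):=\nabla c(x)^T\in\mathbb{R}^{m\times n}$. Write $f_k=f(x_k)$, $c_k=c(x_k)$, $J_k=J(x_k)$; $\mathbb{N}=\{0,1,2,\dots\}$. Standing assumptions. (A1) $\mathcal{X}\subseteq\mathbb{R}^n$ is an open convex set containing the iterates $\{x_k\}$ of every run. Over $\mathcal{X}$: $f$ is continuously differentiable and bounded, $\nabla f$ is bounded and Lipschitz with constant $L>0$; $c$ is continuously differentiable and bounded, $J$ is bounded and Lipschitz with constant $\Gamma>0$ (all with respect to $\|\cdot\|_2$). (A2) $H_k\in\mathbb{R}^{n\times n}$ is symmetric, chosen independently of $g_k$, $\|H_k\|_2\le\kappa_H$, and $u^TH_ku\ge\zeta\|u\|_2^2$ for all $u\in\mathrm{Null}(J_k)$, with $\kappa_H,\zeta>0$ independent of $k$. (The stochastic gradients $g_k$ are assumed to satisfy the assumption on $E_{\tau,\mathrm{zero}}$ below.) Algorithm (stochastic SQP). Inputs: $L,\Gamma$; $\{\beta_k\}\subset(0,1]$; $x_0\in\mathbb{R}^n$; $\tau_{-1},\chi_{-1},\zeta_{-1},\xi_{-1},\omega,\epsilon_\chi>0$; $\epsilon_v\in(0,1]$; $\sigma,\epsilon_\tau,\epsilon_\zeta,\epsilon_\xi,\eta\in(0,1)$; $\theta\ge0$. Let $\Delta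 l(x,\tau,g,d):=-\tau g^Td+\|c(x)\|_2-\|c(x)+J(x)d\|_2$. For $k=0,1,2,\dots$: 1. If $J_k^Tc_k=0$ and $c_k\neq0$, terminate; it is assumed throughout that this never happens, so infinitely many iterates are generated. 2. Obtain $g_k$. 3. Compute (deterministically given $x_k$) $v_k\in\mathrm{Range}(J_k^T)$ with $\|v_k\|_2\le\omega\|J_k^Tc_k\|_2$ and $\|c_k\|_2-\|c_k+J_kv_k\|_2\ge\epsilon_v(\|c_k\|_2-\|c_k+\alpha_k^CJ_kv_k^C\|_2)$, where $v_k^C=-J_k^Tc_k$ and $\alpha_k^C$ minimizes $\frac12\|c_k+\alpha J_kv_k^C\|_2^2$ over $\alpha\in[0,\omega]$. 4. Compute $(u_k,y_k)$ solving $H_ku_k+J_k^Ty_k=-(g_k+H_kv_k)$, $J_ku_k=0$ ($u_k$ is unique); set $d_k=v_k+u_k$. 5. If $d_k=0$, set $\tau_k^{\mathrm{trial}}=\infty$, $(\tau_k,\chi_k,\zeta_k,\xi_k)=(\tau_{k-1},\chi_{k-1},\zeta_{k-1},\xi_{k-1})$ and $\alpha_k=1$. Otherwise: - $\tau_k^{\mathrm{trial}}=\infty$ if $g_k^Td_k+u_k^TH_ku_k\le0$, else $\tau_k^{\mathrm{trial}}=\frac{(1-\sigma)(\|c_k\|_2-\|c_k+J_kd_k\|_2)}{g_k^Td_k+u_k^TH_ku_k}$; $\tau_k=\tau_{k-1}$ if $\tau_{k-1}\le\tau_k^{\mathrm{trial}}$, else $\tau_k=\min\{(1-\epsilon_\tau)\tau_{k-1},\tau_k^{\mathrm{trial}}\}$.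 - $(\chi_k,\zeta_k)=((1+\epsilon_\chi)\chi_{k-1},(1-\epsilon_\zeta)\zeta_{k-1})$ if $\|u_k\|_2^2\ge\chi_{k-1}\|v_k\|_2^2$ and $\frac12d_k^TH_kd_k<\frac14\zeta_{k-1}\|u_k\|_2^2$; else $(\chi_k,\zeta_k)=(\chi_{k-1},\zeta_{k-1})$. - $\xi_k^{\mathrm{trial}}=\frac{\Delta l(x_k,\tau_k,g_k,d_k)}{\tau_k\|d_k\|_2^2}$ if $\|u_k\|_2^2\ge\chi_k\|v_k\|_2^2$, else $\xi_k^{\mathrm{trial}}=\frac{\Delta l(x_k,\tau_k,g_k,d_k)}{\|d_k\|_2^2}$; $\xi_k=\xi_{k-1}$ if $\xi_{k-1}\le\xi_k^{\mathrm{trial}}$, else $\xi_k=\min\{(1-\epsilon_\xi)\xi_{k-1},\xi_k^{\mathrm{trial}}\}$. - $\alpha_k^{\mathrm{suff}}=\min\left\{\frac{2(1-\eta)\beta_k\Delta l(x_k,\tau_k,g_k,d_k)}{(\tau_kL+\Gamma)\|d_k\|_2^2},1\right\}$, and $\alpha_k$ is the projection of $\alpha_k^{\mathrm{suff}}$ onto $[a_k,a_k+\theta\beta_k^2]$, where $a_k=\frac{2(1-\eta)\beta_k\xi_k\tau_k}{\tau_kL+\Gamma}$ if $\|u_k\|_2^2\ge\chi_k\|v_k\|_2^2$ and $a_k=\frac{2(1-\eta)\beta_k\xi_k}{\tau_kL+\Gamma}$ otherwise. 6. $x_{k+1}=x_k+\alpha_kd_k$. Assumption on $E_{\tau,\mathrm{zero}}$: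 in the run, the event $E_{\tau,\mathrm{zero}}$ occurs, i.e., $\{\tau_k\}\searrow0$. In addition, for all $k$, $\mathbb{E}_{k,\tau,\mathrm{zero}}[g_k]=\nabla f(x_k)$ and $\|g_k-\nabla f(x_k)\|_2^2\le M$ for a constant $M>0$, where $\mathbb{E}_{k,\tau,\mathrm{zero}}$ denotes expectation conditioned on $E_{\tau,\mathrm{zero}}$ occurring and the algorithm having reached $x_k$ in iteration $k$. *)

theory Defs
  imports "HOL-Probability.Probability"
begin

text \<open>
  The norm on \<open>real^'n^'m\<close> is the Frobenius norm, whereas here
  matrices are measured in the norm induced by the Euclidean vector norms.
\<close>

definition spectral_norm :: "real^'n^'m \<Rightarrow> real" where
  "spectral_norm A = onorm ((*v) A)"

text \<open>
  The matrix \<open>J x\<close> is the Jacobian of \<open>c\<close>, i.e. the transpose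
  of the matrix whose columns are the constraint gradients.
\<close>

definition smooth_on ::
  "(real^'n) set \<Rightarrow> (real^'n \<Rightarrow> real) \<Rightarrow> (real^'n \<Rightarrow> real^'n)
    \<Rightarrow> (real^'n \<Rightarrow> real^'m) \<Rightarrow> (real^'n \<Rightarrow> real^'n^'m) \<Rightarrow> real \<Rightarrow> real \<Rightarrow> bool" where
  "smooth_on S f gradf c J L \<Gamma> \<longleftrightarrow>
     open S \<and> convex S \<and>
     (\<forall>x\<in>S. GDERIV f x :> gradf x) \<and> continuous_on S gradf \<and>
     bounded (f ` S) \<and> bounded (gradf ` S) \<and>
     (\<forall>x\<in>S. \<forall>y\<in>S. norm (gradf x - gradf y) \<le> L * norm (x - y)) \<and>
     (\<forall>x\<in>S. (c has_derivative (*v) (J x)) (at x)) \<and> continuous_on S J \<and>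
     bounded (c ` S) \<and> bounded (J ` S) \<and>
     (\<forall>x\<in>S. \<forall>y\<in>S. spectral_norm (J x - J y) \<le> \<Gamma> * norm (x - y))"

text \<open>
  Inputs of the algorithm. The fields \<open>tau_init\<close>, \<open>chi_init\<close>,
  \<open>zeta_init\<close>, \<open>xi_init\<close> are the values with index \<open>-1\<close>.
\<close>

record ('n::finite) sqp_input =
  lip_grad :: real
  lip_jac :: real
  beta :: "nat \<Rightarrow> real"
  x_init :: "real^'n"
  tau_init :: real
  chi_init :: real
  zeta_init :: real
  xi_init :: real
  omega :: real
  eps_chi :: real
  eps_v :: real
  suff_decr :: real (* sigma *)
  eps_tau :: real
  eps_zeta :: real
  eps_xi :: real
  eta :: real
  theta :: real

definition valid_input :: "('n::finite) sqp_input \<Rightarrow> bool" where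
  "valid_input p \<longleftrightarrow>
     lip_grad p > 0 \<and> lip_jac p > 0 \<and> (\<forall>k. beta p k \<in> {0<..1}) \<and>
     tau_init p > 0 \<and> chi_init p > 0 \<and> zeta_init p > 0 \<and> xi_init p > 0 \<and>
     omega p > 0 \<and> eps_chi p > 0 \<and> eps_v p \<in> {0<..1} \<and>
     suff_decr p \<in> {0<..<1} \<and> eps_tau p \<in> {0<..<1} \<and> eps_zeta p \<in> {0<..<1} \<and>
     eps_xi p \<in> {0<..<1} \<and> eta p \<in> {0<..<1} \<and> theta p \<ge> 0"

text \<open>
  One run: the sequences \<open>x\<close>, \<open>g\<close>, \<open>H\<close>, \<open>v\<close>,
  \<open>u\<close>, \<open>y\<close>, \<open>\<tau>\<close>, \<open>\<chi>\<close>, \<open>\<zeta>\<close>,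
  \<open>\<xi>\<close>, \<open>\<alpha>\<close>, all indexed from \<open>0\<close>.
\<close>

record ('n::finite, 'm::finite) sqp_run =
  rx :: "nat \<Rightarrow> real^'n"
  rg :: "nat \<Rightarrow> real^'n"
  rH :: "nat \<Rightarrow> real^'n^'n"
  rv :: "nat \<Rightarrow> real^'n"
  ru :: "nat \<Rightarrow> real^'n"
  ry :: "nat \<Rightarrow> real^'m"
  rtau :: "nat \<Rightarrow> real"
  rchi :: "nat \<Rightarrow> real"
  rzeta :: "nat \<Rightarrow> real"
  rxi :: "nat \<Rightarrow> real"
  ralpha :: "nat \<Rightarrow> real"

definition rd :: "('n::finite, 'm::finite) sqp_run \<Rightarrow> nat \<Rightarrow> real^'n" where
  "rd r k = rv r k + ru r k"

definition prev :: "real \<Rightarrow> (nat \<Rightarrow> real) \<Rightarrow> nat \<Rightarrow> real" where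
  "prev init s k = (case k of 0 \<Rightarrow> init | Suc j \<Rightarrow> s j)"

definition model_reduction ::
  "(real^'n \<Rightarrow> real^'m) \<Rightarrow> (real^'n \<Rightarrow> real^'n^'m) \<Rightarrow> real^'n \<Rightarrow> real \<Rightarrow> real^'n \<Rightarrow> real^'n \<Rightarrow> real" where
  "model_reduction c J x \<tau> g d = - \<tau> * (g \<bullet> d) + norm (c x) - norm (c x + J x *v d)"

text \<open>
  Range and Cauchy decrease conditions on the normal component \<open>v\<close> at \<open>x\<close>.
\<close>

definition normal_step ::
  "('n::finite) sqp_input \<Rightarrow> (real^'n \<Rightarrow> real^'m) \<Rightarrow> (real^'n \<Rightarrow> real^'n^'m) \<Rightarrow> real^'n \<Rightarrow> real^'n \<Rightarrow> bool" where
  "normal_step p c J x v \<longleftrightarrow>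
     v \<in> range ((*v) (transpose (J x))) \<and>
     norm v \<le> omega p * norm (transpose (J x) *v c x) \<and>
     (let vC = - (transpose (J x) *v c x) in
       \<exists>\<alpha>C. is_arg_min (\<lambda>\<alpha>. 1/2 * (norm (c x + \<alpha> *\<^sub>R (J x *v vC)))\<^sup>2) (\<lambda>\<alpha>. \<alpha> \<in> {0..omega p}) \<alpha>C \<and>
         norm (c x) - norm (c x + J x *v v)
           \<ge> eps_v p * (norm (c x) - norm (c x + \<alpha>C *\<^sub>R (J x *v vC))))"

definition tangential_step ::
  "real^'n^'m \<Rightarrow> real^'n^'n \<Rightarrow> real^'n \<Rightarrow> real^'n \<Rightarrow> real^'n \<Rightarrow> real^'m \<Rightarrow> bool" where
  "tangential_step Jk H g v u y \<longleftrightarrow>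
     H *v u + transpose Jk *v y = - (g + H *v v) \<and> Jk *v u = 0"

definition tau_trial ::
  "('n::finite) sqp_input \<Rightarrow> (real^'n \<Rightarrow> real^'m) \<Rightarrow> (real^'n \<Rightarrow> real^'n^'m)
    \<Rightarrow> ('n, 'm::finite) sqp_run \<Rightarrow> nat \<Rightarrow> ereal" where
  "tau_trial p c J r k =
     (let x = rx r k; d = rd r k; q = rg r k \<bullet> d + ru r k \<bullet> (rH r k *v ru r k) in
      if d = 0 \<or> q \<le> 0 then \<infinity>
      else ereal ((1 - suff_decr p) * (norm (c x) - norm (c x + J x *v d)) / q))"

definition tau_update ::
  "('n::finite) sqp_input \<Rightarrow> (real^'n \<Rightarrow> real^'m) \<Rightarrow> (real^'n \<Rightarrow> real^'n^'m)
    \<Rightarrow> ('n, 'm::finite) sqp_run \<Rightarrow> nat \<Rightarrow> bool" where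
  "tau_update p c J r k \<longleftrightarrow>
     (let \<tau> = prev (tau_init p) (rtau r) k; t = tau_trial p c J r k in
      rtau r k = (if ereal \<tau> \<le> t then \<tau> else min ((1 - eps_tau p) * \<tau>) (real_of_ereal t)))"

definition chi_zeta_update ::
  "('n::finite) sqp_input \<Rightarrow> ('n, 'm::finite) sqp_run \<Rightarrow> nat \<Rightarrow> bool" where
  "chi_zeta_update p r k \<longleftrightarrow>
     (let ch = prev (chi_init p) (rchi r) k; ze = prev (zeta_init p) (rzeta r) k; d = rd r k in
      (rchi r k, rzeta r k) =
        (if (norm (ru r k))\<^sup>2 \<ge> ch * (norm (rv r k))\<^sup>2 \<and>
            1/2 * (d \<bullet> (rH r k *v d)) < 1/4 * ze * (norm (ru r k))\<^sup>2
         then ((1 + eps_chi p) * ch, (1 - eps_zeta p) * ze)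
         else (ch, ze)))"

definition tangentially_dominated :: "('n::finite, 'm::finite) sqp_run \<Rightarrow> nat \<Rightarrow> bool" where
  "tangentially_dominated r k \<longleftrightarrow> (norm (ru r k))\<^sup>2 \<ge> rchi r k * (norm (rv r k))\<^sup>2"

definition xi_update ::
  "('n::finite) sqp_input \<Rightarrow> (real^'n \<Rightarrow> real^'m) \<Rightarrow> (real^'n \<Rightarrow> real^'n^'m)
    \<Rightarrow> ('n, 'm::finite) sqp_run \<Rightarrow> nat \<Rightarrow> bool" where
  "xi_update p c J r k \<longleftrightarrow>
     (let \<xi> = prev (xi_init p) (rxi r) k; d = rd r k;
          \<Delta> = model_reduction c J (rx r k) (rtau r k) (rg r k) d;
          t = (if tangentially_dominated r k then \<Delta> / (rtau r k * (norm d)\<^sup>2) else \<Delta> / (norm d)\<^sup>2) in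
      rxi r k = (if \<xi> \<le> t then \<xi> else min ((1 - eps_xi p) * \<xi>) t))"

definition step_size ::
  "('n::finite) sqp_input \<Rightarrow> (real^'n \<Rightarrow> real^'m) \<Rightarrow> (real^'n \<Rightarrow> real^'n^'m)
    \<Rightarrow> ('n, 'm::finite) sqp_run \<Rightarrow> nat \<Rightarrow> bool" where
  "step_size p c J r k \<longleftrightarrow>
     (let d = rd r k; D = rtau r k * lip_grad p + lip_jac p;
          \<Delta> = model_reduction c J (rx r k) (rtau r k) (rg r k) d;
          suff = min (2 * (1 - eta p) * beta p k * \<Delta> / (D * (norm d)\<^sup>2)) 1;
          a = (if tangentially_dominated r k
               then 2 * (1 - eta p) * beta p k * rxi r k * rtau r k / D
               else 2 * (1 - eta p) * beta p k * rxi r k / D) in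
      ralpha r k = closest_point {a .. a + theta p * (beta p k)\<^sup>2} suff)"

text \<open>
  The map \<open>V k\<close> is the deterministic rule that produces the normal component
  in iteration \<open>k\<close> from the iterate alone.
\<close>

definition sqp_iteration ::
  "('n::finite) sqp_input \<Rightarrow> (real^'n \<Rightarrow> real^'m) \<Rightarrow> (real^'n \<Rightarrow> real^'n^'m)
    \<Rightarrow> (nat \<Rightarrow> real^'n \<Rightarrow> real^'n) \<Rightarrow> ('n, 'm::finite) sqp_run \<Rightarrow> nat \<Rightarrow> bool" where
  "sqp_iteration p c J V r k \<longleftrightarrow>
     \<not> (transpose (J (rx r k)) *v c (rx r k) = 0 \<and> c (rx r k) \<noteq> 0) \<and>
     rv r k = V k (rx r k) \<and> normal_step p c J (rx r k) (rv r k) \<and>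
     tangential_step (J (rx r k)) (rH r k) (rg r k) (rv r k) (ru r k) (ry r k) \<and>
     (if rd r k = 0 then
        rtau r k = prev (tau_init p) (rtau r) k \<and> rchi r k = prev (chi_init p) (rchi r) k \<and>
        rzeta r k = prev (zeta_init p) (rzeta r) k \<and> rxi r k = prev (xi_init p) (rxi r) k \<and>
        ralpha r k = 1
      else
        tau_update p c J r k \<and> chi_zeta_update p r k \<and> xi_update p c J r k \<and> step_size p c J r k) \<and>
     rx r (Suc k) = rx r k + ralpha r k *\<^sub>R rd r k"

text \<open>
  Since no iteration terminates the algorithm, a run consists of infinitely many iterations.
\<close>

definition is_sqp_run ::
  "('n::finite) sqp_input \<Rightarrow> (real^'n \<Rightarrow> real^'m) \<Rightarrow> (real^'n \<Rightarrow> real^'n^'m)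
    \<Rightarrow> (nat \<Rightarrow> real^'n \<Rightarrow> real^'n) \<Rightarrow> ('n, 'm::finite) sqp_run \<Rightarrow> bool" where
  "is_sqp_run p c J V r \<longleftrightarrow> rx r 0 = x_init p \<and> (\<forall>k. sqp_iteration p c J V r k)"

text \<open>
  A stochastic run is a map from a probability space to runs. The multipliers
  \<open>y\<close> need not be unique, and no measurability is asked of them.
\<close>

definition measurable_run :: "'w measure \<Rightarrow> ('w \<Rightarrow> ('n::finite, 'm::finite) sqp_run) \<Rightarrow> bool" where
  "measurable_run M R \<longleftrightarrow>
     (\<forall>k. (\<lambda>w. rx (R w) k) \<in> borel_measurable M \<and> (\<lambda>w. rg (R w) k) \<in> borel_measurable M \<and>
          (\<lambda>w. rH (R w) k) \<in> borel_measurable M \<and> (\<lambda>w. rv (R w) k) \<in> borel_measurable M \<and>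
          (\<lambda>w. ru (R w) k) \<in> borel_measurable M \<and> (\<lambda>w. rtau (R w) k) \<in> borel_measurable M \<and>
          (\<lambda>w. rchi (R w) k) \<in> borel_measurable M \<and> (\<lambda>w. rzeta (R w) k) \<in> borel_measurable M \<and>
          (\<lambda>w. rxi (R w) k) \<in> borel_measurable M \<and> (\<lambda>w. ralpha (R w) k) \<in> borel_measurable M)"

text \<open>
  The sigma-algebra of what is known before \<open>H\<close> and \<open>g\<close> are chosen in
  iteration \<open>k\<close>; the remaining quantities of earlier iterations are functions of these.
\<close>

definition history :: "'w measure \<Rightarrow> ('w \<Rightarrow> ('n::finite, 'm::finite) sqp_run) \<Rightarrow> nat \<Rightarrow> 'w measure" where
  "history M R k = sigma (space M)
     ({(\<lambda>w. rx (R w) j) -` A \<inter> space M | j A. j \<le> k \<and> A \<in> sets borel} \<union>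
      {(\<lambda>w. rg (R w) j) -` A \<inter> space M | j A. j < k \<and> A \<in> sets borel} \<union>
      {(\<lambda>w. rH (R w) j) -` A \<inter> space M | j A. j < k \<and> A \<in> sets borel})"

definition cond_indep_var ::
  "'w measure \<Rightarrow> 'w measure \<Rightarrow> ('w \<Rightarrow> 'a::topological_space) \<Rightarrow> ('w \<Rightarrow> 'b::topological_space) \<Rightarrow> bool" where
  "cond_indep_var M F X Y \<longleftrightarrow>
     (\<forall>A\<in>sets borel. \<forall>B\<in>sets borel. AE w in M.
        real_cond_exp M F (\<lambda>w. indicator A (X w) * indicator B (Y w)) w =
        real_cond_exp M F (\<lambda>w. indicator A (X w)) w * real_cond_exp M F (\<lambda>w. indicator B (Y w)) w)"

text \<open>
  Both \<open>H\<close> and \<open>g\<close> depend on the iterate, so their independence is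
  conditional on the past.
\<close>

definition hessian_assumption ::
  "'w measure \<Rightarrow> (real^'n \<Rightarrow> real^'n^'m) \<Rightarrow> ('w \<Rightarrow> ('n::finite, 'm::finite) sqp_run)
    \<Rightarrow> real \<Rightarrow> real \<Rightarrow> bool" where
  "hessian_assumption M J R \<kappa>H \<zeta> \<longleftrightarrow>
     \<kappa>H > 0 \<and> \<zeta> > 0 \<and>
     (\<forall>k. cond_indep_var M (history M R k) (\<lambda>w. rH (R w) k) (\<lambda>w. rg (R w) k)) \<and>
     (\<forall>w\<in>space M. \<forall>k.
        transpose (rH (R w) k) = rH (R w) k \<and> spectral_norm (rH (R w) k) \<le> \<kappa>H \<and>
        (\<forall>u. J (rx (R w) k) *v u = 0 \<longrightarrow> u \<bullet> (rH (R w) k *v u) \<ge> \<zeta> * (norm u)\<^sup>2))"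

definition E_tau_zero :: "'w measure \<Rightarrow> ('w \<Rightarrow> ('n::finite, 'm::finite) sqp_run) \<Rightarrow> 'w set" where
  "E_tau_zero M R = {w \<in> space M. decseq (rtau (R w)) \<and> rtau (R w) \<longlonglongrightarrow> 0}"

text \<open>
  The expectation conditioned on the event and on the iterate reached in iteration
  \<open>k\<close> is the conditional expectation given \<open>x\<^sub>k\<close>, taken with
  respect to the probability measure conditioned on the event. For a null event
  \<open>uniform_measure\<close> is the zero measure and the condition is void.
\<close>

definition tau_zero_assumption ::
  "'w measure \<Rightarrow> (real^'n \<Rightarrow> real^'n) \<Rightarrow> ('w \<Rightarrow> ('n::finite, 'm::finite) sqp_run) \<Rightarrow> real \<Rightarrow> bool" where
  "tau_zero_assumption M gradf R B \<longleftrightarrow>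
     B > 0 \<and>
     (\<forall>k i. AE w in uniform_measure M (E_tau_zero M R).
        real_cond_exp (uniform_measure M (E_tau_zero M R))
          (vimage_algebra (space M) (\<lambda>w. rx (R w) k) borel) (\<lambda>w. rg (R w) k $ i) w
        = gradf (rx (R w) k) $ i) \<and>
     (\<forall>w\<in>E_tau_zero M R. \<forall>k. (norm (rg (R w) k - gradf (rx (R w) k)))\<^sup>2 \<le> B)"

end

theory Submission
  imports Defs
begin

text \<open>
  The argument is pathwise and rests on the merit parameter. Write \<open>s = \<parallel>J\<^sub>k\<^sup>T c\<^sub>k\<parallel>\<close>. The Cauchy condition gives
  a decrease \<open>\<parallel>c\<^sub>k\<parallel> - \<parallel>c\<^sub>k + J\<^sub>k d\<^sub>k\<parallel>\<close> of order at least
  \<open>s\<^sup>2\<close>. The tangential system turns \<open>g\<^sub>k\<^sup>T d\<^sub>k + u\<^sub>k\<^sup>T H\<^sub>k u\<^sub>k\<close>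
  into \<open>g\<^sub>k\<^sup>T v\<^sub>k - u\<^sub>k\<^sup>T H\<^sub>k v\<^sub>k\<close>, which is of order at most
  \<open>\<parallel>v\<^sub>k\<parallel> \<le> \<omega> s\<close>, because the stochastic gradients are bounded on the event.
  Hence every trial value is at least a multiple of \<open>s\<close>: were \<open>s\<close> bounded away from zero,
  the merit parameter would be too, and it could not tend to zero.
\<close>

section \<open>Operator bounds for matrices and their transposes\<close>

lemma bounded_matrix_family:
  fixes \<A> :: "(real^'n^'m) set"
  assumes "bounded \<A>"
  obtains K where "K > 0" "\<And>A y. A \<in> \<A> \<Longrightarrow> norm (A *v y) \<le> K * norm y"
proof -
  obtain B where B: "B > 0" "\<And>A. A \<in> \<A> \<Longrightarrow> norm A \<le> B"
    using assms bounded_pos by metis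
  \<comment> \<open>A crude entrywise bound: each entry is at most the Frobenius norm in absolute
    value. Only uniformity over the family matters later, not the size of \<open>K\<close>.\<close>
  define K where "K = real CARD('m) * real CARD('n) * B"
  have "K > 0" using B by (simp add: K_def)
  moreover have "norm (A *v y) \<le> K * norm y" if "A \<in> \<A>" for A y
  proof -
    have "\<bar>A $ i $ j\<bar> \<le> B" for i j
      using component_le_norm_cart[of "A $ i" j] Finite_Cartesian_Product.norm_nth_le[of A i]
        B(2)[OF that] by linarith
    then have "onorm ((*v) A) \<le> K"
      unfolding K_def by (rule onorm_le_matrix_component)
    then show ?thesis
      using onorm[OF matrix_vector_mul_bounded_linear, of A y]
      by (meson mult_right_mono norm_ge_zero order_trans)
  qed
  ultimately show thesis using that by blast
qed

lemma inner_transpose_left: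
  fixes A :: "real^'n^'m"
  shows "(transpose A *v y) \<bullet> x = y \<bullet> (A *v x)"
  by (simp add: dot_lmul_matrix transpose_matrix_vector)

text \<open>Pairing \<open>transpose A *v y\<close> with itself moves the transpose away;
  Cauchy-Schwarz then leaves one factor of its norm to cancel.\<close>

lemma norm_transpose_mult_le:
  fixes A :: "real^'n^'m"
  assumes "\<And>x. norm (A *v x) \<le> K * norm x" "K \<ge> 0"
  shows "norm (transpose A *v y) \<le> K * norm y"
proof (cases "transpose A *v y = 0")
  case False
  let ?z = "transpose A *v y"
  have "norm ?z * norm ?z = y \<bullet> (A *v ?z)"
    by (metis inner_transpose_left power2_eq_square power2_norm_eq_inner)
  also have "\<dots> \<le> norm y * norm (A *v ?z)"
    by (rule norm_cauchy_schwarz)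
  also have "\<dots> \<le> norm y * (K * norm ?z)"
    using assms(1) by (rule mult_left_mono) simp
  finally have "norm ?z * norm ?z \<le> (K * norm y) * norm ?z"
    by (simp add: mult_ac)
  then show ?thesis using False by simp
qed (use assms in simp)

text \<open>The minimizing Cauchy step does at least as well as any fixed admissible step
  \<open>a\<close>, so it suffices to find an \<open>a\<close> for which the squared residual drops
  by \<open>a * b\<close>. Factoring the difference of squares, with both norms at most
  \<open>C\<close>, turns this into a drop of the norm itself.\<close>

lemma cauchy_decrease:
  fixes c :: "real^'n \<Rightarrow> real^'m"
  assumes step: "normal_step p c J x v"
    and om: "omega p > 0" and ev: "eps_v p \<ge> 0"
    and C: "C > 0" "norm (c x) \<le> C"
    and K: "K > 0" "\<And>y. norm (J x *v y) \<le> K * norm y"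
  shows "norm (c x) - norm (c x + J x *v v)
    \<ge> eps_v p * (min (omega p) (1 / K\<^sup>2) / (2 * C)) * (norm (transpose (J x) *v c x))\<^sup>2"
proof -
  define z where "z = transpose (J x) *v c x"
  define b where "b = (norm z)\<^sup>2"
  \<comment> \<open>The first entry keeps \<open>a\<close> in the search interval. The second makes
    the quadratic term of the residual consume at most half of the linear gain
    \<open>2 * a * b\<close>.\<close>
  define a where "a = min (omega p) (1 / K\<^sup>2)"
  define e where "e = c x - a *\<^sub>R (J x *v z)"
  have a: "0 < a" "a \<le> omega p" "a \<le> 1 / K\<^sup>2"
    using om K by (auto simp: a_def)
  then have aK: "a * K\<^sup>2 \<le> 1"
    using K by (simp add: pos_le_divide_eq)
  have neg: "J x *v - z = - (J x *v z)"
    using linear_neg[OF matrix_vector_mul_linear[of "J x"], of z] by simp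
  obtain t where
      t: "is_arg_min (\<lambda>\<alpha>. 1/2 * (norm (c x + \<alpha> *\<^sub>R (J x *v - z)))\<^sup>2) (\<lambda>\<alpha>. \<alpha> \<in> {0..omega p}) t"
    and dec: "norm (c x) - norm (c x + J x *v v) \<ge> eps_v p * (norm (c x) - norm (c x + t *\<^sub>R (J x *v - z)))"
    using step unfolding normal_step_def Let_def z_def by blast
  have "a \<in> {0..omega p}" using a by simp
  then have "(norm (c x + t *\<^sub>R (J x *v - z)))\<^sup>2 \<le> (norm e)\<^sup>2"
    using t by (fastforce simp: is_arg_min_def e_def neg not_less)
  then have le_e: "norm (c x + t *\<^sub>R (J x *v - z)) \<le> norm e"
    by (rule power2_le_imp_le) simp
  have cw: "c x \<bullet> (J x *v z) = b"
    by (simp add: b_def z_def power2_norm_eq_inner flip: inner_transpose_left)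
  have Jz: "(norm (J x *v z))\<^sup>2 \<le> K\<^sup>2 * b"
    using power_mono[OF K(2)[of z], of 2] by (simp add: b_def power_mult_distrib)
  have "(norm e)\<^sup>2 = (norm (c x))\<^sup>2 - 2 * a * b + a\<^sup>2 * (norm (J x *v z))\<^sup>2"
    unfolding e_def power2_norm_eq_inner
    by (simp add: inner_diff_left inner_diff_right inner_commute cw power2_eq_square algebra_simps)
  also have "\<dots> \<le> (norm (c x))\<^sup>2 - 2 * a * b + a\<^sup>2 * (K\<^sup>2 * b)"
    using Jz by (simp add: mult_left_mono)
  also have "a\<^sup>2 * (K\<^sup>2 * b) = (a * K\<^sup>2) * (a * b)"
    by (simp add: power2_eq_square)
  also have "\<dots> \<le> 1 * (a * b)"
    using a aK by (intro mult_right_mono) (auto simp: b_def)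
  finally have sq: "a * b \<le> (norm (c x))\<^sup>2 - (norm e)\<^sup>2" by simp
  have ab: "0 \<le> a * b" using a by (simp add: b_def)
  with sq have "(norm e)\<^sup>2 \<le> (norm (c x))\<^sup>2" by linarith
  then have e_le: "norm e \<le> norm (c x)" by (rule power2_le_imp_le) simp
  have "a * b \<le> (norm (c x) - norm e) * (norm (c x) + norm e)"
    using sq by (simp add: power2_eq_square algebra_simps)
  also have "\<dots> \<le> (norm (c x) - norm e) * (2 * C)"
    using e_le C by (intro mult_left_mono) auto
  finally have "a / (2 * C) * b \<le> norm (c x) - norm e"
    using C by (simp add: field_simps)
  then have "a / (2 * C) * b \<le> norm (c x) - norm (c x + t *\<^sub>R (J x *v - z))"
    using le_e by linarith
  from mult_left_mono[OF this ev] dec show ?thesis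
    unfolding a_def b_def z_def by (simp add: mult_ac)
qed

section \<open>The tangential step and the denominator of the trial value\<close>

lemma norm_matrix_mult_le_spectral:
  fixes A :: "real^'n^'m"
  assumes "spectral_norm A \<le> k"
  shows "norm (A *v x) \<le> k * norm x"
  using onorm[OF matrix_vector_mul_bounded_linear, of A x] assms
  unfolding spectral_norm_def by (meson mult_right_mono norm_ge_zero order_trans)

text \<open>Pairing the first block of the system with \<open>u\<close> removes the multiplier,
  since \<open>u\<close> lies in the null space of \<open>Jk\<close>.\<close>

lemma tangential_step_identity:
  fixes Jk :: "real^'n^'m"
  assumes "tangential_step Jk H g v u y"
  shows "g \<bullet> u + u \<bullet> (H *v u) = - (u \<bullet> (H *v v))"
proof -
  have "u \<bullet> (H *v u) + u \<bullet> (transpose Jk *v y) = - (u \<bullet> (g + H *v v))"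
    using assms unfolding tangential_step_def by (metis inner_add_right inner_minus_right)
  moreover have "u \<bullet> (transpose Jk *v y) = 0"
    using assms by (metis inner_commute inner_transpose_left inner_zero_right tangential_step_def)
  ultimately show ?thesis
    by (simp add: inner_add_right inner_commute)
qed

text \<open>Curvature on the null space first bounds \<open>norm u\<close> by a constant. The
  identity then leaves \<open>g \<bullet> v - u \<bullet> (H *v v)\<close>, whose two terms are
  linear in \<open>v\<close>.\<close>

lemma tangential_step_bounds:
  fixes Jk :: "real^'n^'m"
  assumes step: "tangential_step Jk H g v u y"
    and H: "\<And>x. norm (H *v x) \<le> \<kappa> * norm x" "\<kappa> > 0"
    and curv: "u \<bullet> (H *v u) \<ge> \<zeta> * (norm u)\<^sup>2" "\<zeta> > 0"
    and g: "norm g \<le> G" and v: "norm v \<le> W"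
  shows "g \<bullet> (v + u) + u \<bullet> (H *v u) \<le> (G + (G + \<kappa> * W) / \<zeta> * \<kappa>) * norm v"
proof -
  note id = tangential_step_identity[OF step]
  have uHv: "\<bar>u \<bullet> (H *v v)\<bar> \<le> norm u * (\<kappa> * norm v)"
    using Cauchy_Schwarz_ineq2[of u "H *v v"] mult_left_mono[OF H(1)[of v] norm_ge_zero[of u]]
    by linarith
  have "\<zeta> * (norm u)\<^sup>2 \<le> - (u \<bullet> (H *v v)) - g \<bullet> u"
    using id curv by linarith
  also have "\<dots> \<le> norm u * (\<kappa> * norm v) + norm g * norm u"
    using uHv Cauchy_Schwarz_ineq2[of g u] by linarith
  also have "\<dots> \<le> norm u * (\<kappa> * W) + G * norm u"
    using H g v by (intro add_mono mult_left_mono mult_right_mono) auto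
  finally have "norm u * (\<zeta> * norm u) \<le> norm u * (G + \<kappa> * W)"
    by (simp add: power2_eq_square algebra_simps)
  \<comment> \<open>Covers \<open>u = 0\<close>, where the common factor \<open>norm u\<close>
    cannot be cancelled.\<close>
  moreover have "0 \<le> G + \<kappa> * W"
    using H g v norm_ge_zero[of g] norm_ge_zero[of v]
    by (meson add_nonneg_nonneg less_imp_le mult_nonneg_nonneg order_trans)
  ultimately have "\<zeta> * norm u \<le> G + \<kappa> * W"
    by (cases "u = 0") auto
  then have u: "norm u \<le> (G + \<kappa> * W) / \<zeta>"
    using curv by (simp add: field_simps)
  have "g \<bullet> (v + u) + u \<bullet> (H *v u) = g \<bullet> v - u \<bullet> (H *v v)"
    using id by (simp add: inner_add_right)
  also have "\<dots> \<le> norm g * norm v + norm u * (\<kappa> * norm v)"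
    using uHv norm_cauchy_schwarz[of g v] by linarith
  also have "\<dots> \<le> G * norm v + (G + \<kappa> * W) / \<zeta> * (\<kappa> * norm v)"
    using g u H by (intro add_mono mult_right_mono) auto
  finally show ?thesis by (simp add: algebra_simps)
qed

text \<open>A decrease of order \<open>s\<^sup>2\<close> over a denominator of order
  \<open>s\<close> makes every trial value that triggers an update at least a multiple of
  \<open>s\<close>. Strict positivity of \<open>s\<close> is recorded so that the merit parameter
  can be shown to stay positive.\<close>

lemma tau_update_lower_bound:
  fixes c :: "real^'n \<Rightarrow> real^'m" and J :: "real^'n \<Rightarrow> real^'n^'m" and r :: "('n, 'm) sqp_run" and k :: nat
  defines "s \<equiv> norm (transpose (J (rx r k)) *v c (rx r k))"
    and "q \<equiv> rg r k \<bullet> rd r k + ru r k \<bullet> (rH r k *v ru r k)"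
  assumes upd: "tau_update p c J r k"
    and sigma: "suff_decr p < 1" and eps: "eps_tau p \<in> {0<..<1}"
    and pos: "\<delta> > 0" "Q > 0"
    and dec: "norm (c (rx r k)) - norm (c (rx r k) + J (rx r k) *v rd r k) \<ge> \<delta> * s\<^sup>2"
    and q: "q \<le> Q * s"
  shows "rtau r k = prev (tau_init p) (rtau r) k \<or>
    s > 0 \<and> rtau r k \<ge> (1 - eps_tau p) * ((1 - suff_decr p) * \<delta> / Q) * s"
proof (cases "ereal (prev (tau_init p) (rtau r) k) \<le> tau_trial p c J r k")
  case True
  then show ?thesis using upd by (simp add: tau_update_def Let_def)
next
  case False
  define D where "D = norm (c (rx r k)) - norm (c (rx r k) + J (rx r k) *v rd r k)"
  define T where "T = (1 - suff_decr p) * D / q"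
  define m where "m = (1 - suff_decr p) * \<delta> / Q * s"
  let ?t = "prev (tau_init p) (rtau r) k"
  \<comment> \<open>A failed comparison excludes the value \<open>\<infinity>\<close>, hence the
    cases \<open>d = 0\<close> and \<open>q \<le> 0\<close>.\<close>
  have qpos: "q > 0" and trial: "tau_trial p c J r k = ereal T"
    using False by (auto simp: tau_trial_def Let_def q_def T_def D_def split: if_splits)
  have s: "s > 0"
    using qpos q pos by (smt (verit) mult_nonneg_nonpos)
  have "0 \<le> \<delta> * s\<^sup>2" using pos by simp
  then have D: "D \<ge> \<delta> * s\<^sup>2" "D \<ge> 0"
    using dec by (auto simp: D_def)
  have "m = (1 - suff_decr p) * (\<delta> * s\<^sup>2) / (Q * s)"
    using s pos by (simp add: m_def power2_eq_square)
  also have "\<dots> \<le> T"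
    unfolding T_def using sigma D q qpos by (intro frac_le mult_left_mono) auto
  finally have mT: "m \<le> T" .
  have m: "0 \<le> m" using s pos sigma by (simp add: m_def)
  have "T < ?t" using False trial by simp
  \<comment> \<open>Both entries of the minimum dominate \<open>(1 - eps_tau p) * m\<close>: the
    previous value exceeds \<open>T\<close>, and \<open>T\<close> is at least
    \<open>m\<close>.\<close>
  then have "(1 - eps_tau p) * m \<le> (1 - eps_tau p) * ?t"
    using mT eps by (intro mult_left_mono) auto
  moreover have "(1 - eps_tau p) * m \<le> 1 * m"
    using eps m by (intro mult_right_mono) auto
  moreover have "rtau r k = min ((1 - eps_tau p) * ?t) T"
    using upd False trial by (simp add: tau_update_def Let_def)
  ultimately have "rtau r k \<ge> (1 - eps_tau p) * m"
    using mT by linarith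
  then show ?thesis using s by (simp add: m_def mult.assoc)
qed

text \<open>The constants come only from bounds over \<open>S\<close>, the inputs and the
  assumptions on \<open>H\<close> and \<open>g\<close>, so a single \<open>\<mu>\<close> serves all
  iterations.\<close>

lemma merit_parameter_dichotomy:
  fixes c :: "real^'n \<Rightarrow> real^'m" and J :: "real^'n \<Rightarrow> real^'n^'m" and r :: "('n, 'm) sqp_run"
  assumes input: "valid_input p"
    and smooth: "smooth_on S f gradf c J L \<Gamma>"
    and run: "is_sqp_run p c J V r" and inS: "\<And>k. rx r k \<in> S"
    and H: "\<And>k. spectral_norm (rH r k) \<le> \<kappa>" "\<kappa> > 0"
    and curv: "\<And>k u. J (rx r k) *v u = 0 \<Longrightarrow> u \<bullet> (rH r k *v u) \<ge> \<zeta> * (norm u)\<^sup>2" "\<zeta> > 0"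
    and g: "\<And>k. (norm (rg r k - gradf (rx r k)))\<^sup>2 \<le> B"
  obtains \<mu> where "\<mu> > 0"
    "\<And>k. rtau r k = prev (tau_init p) (rtau r) k \<or>
      norm (transpose (J (rx r k)) *v c (rx r k)) > 0 \<and>
      rtau r k \<ge> \<mu> * norm (transpose (J (rx r k)) *v c (rx r k))"
proof -
  have params: "omega p > 0" "eps_v p > 0" "suff_decr p < 1" "eps_tau p \<in> {0<..<1}"
    using input by (auto simp: valid_input_def)
  obtain C where C: "C > 0" "\<And>x. x \<in> S \<Longrightarrow> norm (c x) \<le> C"
    using smooth unfolding smooth_on_def bounded_pos by fastforce
  obtain G0 where G0: "G0 > 0" "\<And>x. x \<in> S \<Longrightarrow> norm (gradf x) \<le> G0"
    using smooth unfolding smooth_on_def bounded_pos by fastforce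
  have "bounded (J ` S)" using smooth by (simp add: smooth_on_def)
  then obtain K where K: "K > 0" "\<And>x y. x \<in> S \<Longrightarrow> norm (J x *v y) \<le> K * norm y"
    using bounded_matrix_family[of "J ` S"] by (metis imageI)
  have B: "B \<ge> 0" using g[of 0] zero_le_power2 order_trans by blast
  define G where "G = G0 + sqrt B"
  define W where "W = omega p * (K * C)"
  define Q where "Q = (G + (G + \<kappa> * W) / \<zeta> * \<kappa>) * omega p"
  define \<delta> where "\<delta> = eps_v p * (min (omega p) (1 / K\<^sup>2) / (2 * C))"
  define \<mu> where "\<mu> = (1 - eps_tau p) * ((1 - suff_decr p) * \<delta> / Q)"
  have Gpos: "G > 0" using G0 B by (simp add: G_def add_pos_nonneg)
  have Wpos: "W > 0" using params K C by (simp add: W_def)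
  have fpos: "G + (G + \<kappa> * W) / \<zeta> * \<kappa> > 0"
    using Gpos Wpos H(2) curv(2) by (intro add_pos_pos mult_pos_pos divide_pos_pos) auto
  then have Qpos: "Q > 0" using params by (simp add: Q_def)
  have dpos: "\<delta> > 0" using params K C by (simp add: \<delta>_def)
  have mupos: "\<mu> > 0" using params Qpos dpos by (simp add: \<mu>_def)
  have "rtau r k = prev (tau_init p) (rtau r) k \<or>
      norm (transpose (J (rx r k)) *v c (rx r k)) > 0 \<and>
      rtau r k \<ge> \<mu> * norm (transpose (J (rx r k)) *v c (rx r k))" for k
  proof (cases "rd r k = 0")
    case True
    then show ?thesis using run by (simp add: is_sqp_run_def sqp_iteration_def)
  next
    case False
    let ?x = "rx r k"
    let ?s = "norm (transpose (J ?x) *v c ?x)"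
    have upd: "tau_update p c J r k" and ns: "normal_step p c J ?x (rv r k)"
      and ts: "tangential_step (J ?x) (rH r k) (rg r k) (rv r k) (ru r k) (ry r k)"
      using run[unfolded is_sqp_run_def sqp_iteration_def] False by metis+
    have Ju: "J ?x *v ru r k = 0" using ts by (simp add: tangential_step_def)
    \<comment> \<open>The tangential part does not change the linearized constraint, so the Cauchy
      decrease of \<open>v\<close> carries over to \<open>d\<close>.\<close>
    have Jd: "J ?x *v rd r k = J ?x *v rv r k"
      by (simp add: rd_def matrix_vector_right_distrib Ju)
    have dec: "norm (c ?x) - norm (c ?x + J ?x *v rd r k) \<ge> \<delta> * ?s\<^sup>2"
      unfolding Jd \<delta>_def using params C K inS[of k] by (intro cauchy_decrease[OF ns]) auto
    have v: "norm (rv r k) \<le> omega p * ?s" using ns by (simp add: normal_step_def)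
    have "?s \<le> K * norm (c ?x)"
      using K inS[of k] by (intro norm_transpose_mult_le) auto
    also have "\<dots> \<le> K * C" using K C inS[of k] by simp
    finally have "omega p * ?s \<le> W" unfolding W_def using params by simp
    with v have vW: "norm (rv r k) \<le> W" by linarith
    have "norm (rg r k - gradf ?x) \<le> sqrt B" using g by (rule real_le_rsqrt)
    then have gG: "norm (rg r k) \<le> G"
      using G0(2)[OF inS[of k]] norm_triangle_sub[of "rg r k" "gradf ?x"] by (simp add: G_def)
    have "rg r k \<bullet> rd r k + ru r k \<bullet> (rH r k *v ru r k)
        \<le> (G + (G + \<kappa> * W) / \<zeta> * \<kappa>) * norm (rv r k)"
      unfolding rd_def
      by (rule tangential_step_bounds[OF ts norm_matrix_mult_le_spectral[OF H(1)] H(2)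
            curv(1)[OF Ju] curv(2) gG vW])
    also have "\<dots> \<le> (G + (G + \<kappa> * W) / \<zeta> * \<kappa>) * (omega p * ?s)"
      using fpos v by (intro mult_left_mono) auto
    finally have "rg r k \<bullet> rd r k + ru r k \<bullet> (rH r k *v ru r k) \<le> Q * ?s"
      by (simp add: Q_def mult.assoc)
    then show ?thesis
      unfolding \<mu>_def by (intro tau_update_lower_bound upd params dpos Qpos dec)
  qed
  with mupos show thesis using that by blast
qed

theorem theorem3:
  fixes P :: "'s measure" and \<iota> :: "'s \<Rightarrow> 'i" and I :: "'i measure"
    and F :: "real^'n::finite \<Rightarrow> 'i \<Rightarrow> real"
    and f :: "real^'n \<Rightarrow> real" and gradf :: "real^'n \<Rightarrow> real^'n"
    and c :: "real^'n \<Rightarrow> real^'m::finite" and J :: "real^'n \<Rightarrow> real^'n^'m"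
    and S :: "(real^'n) set"
    and p :: "'n sqp_input" and V :: "nat \<Rightarrow> real^'n \<Rightarrow> real^'n"
    and M :: "'w measure" and R :: "'w \<Rightarrow> ('n, 'm) sqp_run" and w :: 'w
    and \<kappa>H \<zeta> B :: real
  assumes "CARD('m) \<le> CARD('n)"
    and "prob_space P" and "\<iota> \<in> measurable P I"
    and "\<And>x. integrable P (\<lambda>s. F x (\<iota> s))" and "\<And>x. f x = (\<integral>s. F x (\<iota> s) \<partial>P)"
    and "valid_input p"
    and "smooth_on S f gradf c J (lip_grad p) (lip_jac p)"
    and "prob_space M" and "measurable_run M R"
    and "\<And>w. w \<in> space M \<Longrightarrow> is_sqp_run p c J V (R w)"
    and "\<And>w k. w \<in> space M \<Longrightarrow> rx (R w) k \<in> S"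
    and "hessian_assumption M J R \<kappa>H \<zeta>"
    and "tau_zero_assumption M gradf R B"
    and "w \<in> E_tau_zero M R"
    and "\<And>k. beta p k \<in> {0<..1} \<and>
           2 * (1 - eta p) * beta p k * rxi (R w) k * max (rtau (R w) k) 1
             / (rtau (R w) k * lip_grad p + lip_jac p) \<in> {0<..1}"
    and "(\<exists>b\<in>{0<..<1}. \<forall>k. beta p k = b) \<or>
         (filterlim (\<lambda>N. \<Sum>k<N. beta p k) at_top sequentially \<and>
          summable (\<lambda>k. (beta p k)\<^sup>2) \<and>
          (infinite {k. (norm (ru (R w) k))\<^sup>2 < rchi (R w) k * (norm (rv (R w) k))\<^sup>2} \<or>
           filterlim (\<lambda>N. \<Sum>k<N. beta p k * rtau (R w) k) at_top sequentially))"
  shows "liminf (\<lambda>k. ereal (norm (transpose (J (rx (R w) k)) *v c (rx (R w) k)))) = 0"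
proof -
  define s where "s k = norm (transpose (J (rx (R w) k)) *v c (rx (R w) k))" for k
  let ?\<tau> = "rtau (R w)"
  have w: "w \<in> space M" and lim: "?\<tau> \<longlonglongrightarrow> 0"
    using assms(14) by (auto simp: E_tau_zero_def)
  have hess: "\<And>k. spectral_norm (rH (R w) k) \<le> \<kappa>H" "\<kappa>H > 0" "\<zeta> > 0"
    "\<And>k u. J (rx (R w) k) *v u = 0 \<Longrightarrow> u \<bullet> (rH (R w) k *v u) \<ge> \<zeta> * (norm u)\<^sup>2"
    using assms(12) w by (auto simp: hessian_assumption_def)
  have g: "(norm (rg (R w) k - gradf (rx (R w) k)))\<^sup>2 \<le> B" for k
    using assms(13,14) by (auto simp: tau_zero_assumption_def)
  obtain \<mu> where mu: "\<mu> > 0"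
    and step: "\<And>k. ?\<tau> k = prev (tau_init p) ?\<tau> k \<or> s k > 0 \<and> ?\<tau> k \<ge> \<mu> * s k"
    unfolding s_def
    by (rule merit_parameter_dichotomy[OF assms(6,7) assms(10)[OF w] assms(11)[OF w]
          hess(1,2) hess(4,3) g]) blast+
  \<comment> \<open>An unchanged value inherits positivity, starting from \<open>tau_init p\<close>;
    a changed one is positive because \<open>s k > 0\<close>.\<close>
  have pos: "?\<tau> k > 0" for k
  proof (induction k)
    case 0
    then show ?case
      using step[of 0] mu assms(6) by (auto simp: prev_def valid_input_def intro: less_le_trans[of 0 "\<mu> * s 0"])
  next
    case (Suc k)
    then show ?case
      using step[of "Suc k"] mu by (auto simp: prev_def intro: less_le_trans[of 0 "\<mu> * s (Suc k)"])
  qed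
  have nonneg: "0 \<le> liminf (\<lambda>k. ereal (s k))"
    by (intro Liminf_bounded always_eventually allI) (simp add: s_def)
  have "\<not> 0 < liminf (\<lambda>k. ereal (s k))"
  proof
    assume "0 < liminf (\<lambda>k. ereal (s k))"
    then obtain e where e: "0 < ereal e" "ereal e < liminf (\<lambda>k. ereal (s k))"
      using ereal_dense2 by blast
    then have "\<forall>\<^sub>F k in sequentially. e < s k"
      by (auto dest: less_LiminfD)
    then obtain N where N: "\<And>k. k \<ge> N \<Longrightarrow> e < s k"
      by (auto simp: eventually_sequentially)
    \<comment> \<open>From \<open>N\<close> on, the merit parameter either keeps its value, starting
      from \<open>?\<tau> N\<close>, or is reset to at least \<open>\<mu> * e\<close>. So
      \<open>m\<close> is a positive lower bound, contradicting the limit zero.\<close>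
    define m where "m = min (?\<tau> N) (\<mu> * e)"
    have "m > 0" using pos mu e by (simp add: m_def)
    have "m \<le> ?\<tau> k" if "k \<ge> N" for k
      using that
    proof (induction k rule: dec_induct)
      case base
      then show ?case by (simp add: m_def)
    next
      case (step k)
      have "\<mu> * e \<le> \<mu> * s (Suc k)"
        using N[of "Suc k"] step.hyps mu by (intro mult_left_mono) auto
      then show ?case
        using step.IH \<open>\<And>k. ?\<tau> k = prev (tau_init p) ?\<tau> k \<or> s k > 0 \<and> ?\<tau> k \<ge> \<mu> * s k\<close>[of "Suc k"]
        by (auto simp: prev_def m_def)
    qed
    then have "m \<le> 0"
      using lim by (intro tendsto_lowerbound[OF lim, of m]) (auto simp: eventually_sequentially)
    with \<open>m > 0\<close> show False by simp
  qed
  with nonneg show ?thesis unfolding s_def by (simp add: antisym_conv2 not_less)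
qed

end
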